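(* Let $KK^\ast$ denote the class of Banach spaces with the dual Kadec-Klee property. Then $\mathcal E_0\cap\mathcal E=\mathcal E_0\cap KK^\ast$.
   Context: A Banach space $X$ has the dual Kadec-Klee property if whenever $(x_n^\ast)$ is a sequence in $X^\ast$ weak$^\ast$ converging to $x^\ast\in X^\ast$ with $\|x_n^\ast\|\to\|x^\ast\|$, then $(x_n^\ast)$ is norm convergent. Compact spaces are Hausdorff. For a compact space $K$, $\mathcal Q(K)$ is the set of all Hausdorff quotient spaces $L=K/E$ ($E$ an equivalence relation on $K$, quotient topology), each with its canonical projection $p_L:K\to L$. It is ordered by: $L\le L'$ iff there is a continuous surjection $q:L'\to L$ (the natural projection) with $q\,p_{L'}=p_L$; equivalently, the equivalence relation of $L'$ is contained in that of $L$. Suprema in $\mathcal Q(K)$ correspond to intersections of equivalence relations. $\mathcal Q_\omega(K)\subset\mathcal Q(K)$ is the set of quotients of countable weight. A family $\mathcal S\subset\mathcal Q_\omega(K)$ is cofinal if for every $L\in\mathcal Q_\omega(K)$ there is $L'\in\mathcal S$ with $L\le L'$; it is a $\sigma$-semilattice if the supremum of every countable subset of $\mathcal S$ belongs to $\mathcal S$. Given a continuous surjection $\pi:M\to N$, a sequence $(x_n)$ in $N$ converging to $x\in N$ is called $\pi$-fiber convergent if for every $y\in\pi^{-1}(x)$ there are $y_n\in\pi^{-1}(x_n)$ with $y_n\to y$. If $K$ is a compact space of uncountable weight and $(x_n)$ is a sequence in $K$ converging to $x\in K$, then $(x_n)$ is called fiber convergent if there is a cofinal $\sigma$-semilattice $\mathcal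 S\subset\mathcal Q_\omega(K)$ such that for all $L'\le L$ in $\mathcal S$, with natural projection $\pi:L\to L'$, the sequence $(p_{L'}(x_n))_n$ (which converges to $p_{L'}(x)$) is $\pi$-fiber convergent. A nonseparable Banach space $X$ belongs to the class $\mathcal E$ if the fiber convergent sequences of $(B_{X^\ast},w^\ast)$ are exactly the norm convergent sequences of $B_{X^\ast}$. It belongs to the class $\mathcal E_0$ if the fiber convergent sequences of $(B_{X^\ast},w^\ast)$ are exactly those sequences $(x_n^\ast)$ in $B_{X^\ast}$ that are weak$^\ast$ convergent to a point $x^\ast\in B_{X^\ast}$ with $\|x_n^\ast\|\to\|x^\ast\|$. Here $B_{X^\ast}$ is the closed unit ball of the dual $X^\ast$. *)

theory Defs
  imports "HOL-Analysis.Analysis"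
begin

section \<open>Hausdorff quotients of a compact space\<close>

definition quotient_space :: "'a topology \<Rightarrow> ('a \<times> 'a) set \<Rightarrow> 'a set topology" where
  "quotient_space K E =
     topology (\<lambda>U. U \<subseteq> topspace K // E \<and> openin K {x \<in> topspace K. E `` {x} \<in> U})"

definition quotient_proj :: "('a \<times> 'a) set \<Rightarrow> 'a \<Rightarrow> 'a set" where
  "quotient_proj E x = E `` {x}"

text \<open>A quotient \<open>K/E\<close> is represented by the relation \<open>E\<close> itself, so that \<open>\<Q>(K)\<close> is a set of
  relations; the topological space it stands for is \<open>quotient_space K E\<close>.\<close>

definition hausdorff_quotients :: "'a topology \<Rightarrow> ('a \<times> 'a) set set" where
  "hausdorff_quotients K =
     {E. equiv (topspace K) E \<and> Hausdorff_space (quotient_space K E)}"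

definition countable_weight_quotients :: "'a topology \<Rightarrow> ('a \<times> 'a) set set" where
  "countable_weight_quotients K =
     {E \<in> hausdorff_quotients K. second_countable (quotient_space K E)}"

text \<open>\<open>natural_projection K E E' q\<close>: the map \<open>q\<close> is the natural projection of \<open>K/E\<close> onto
  \<open>K/E'\<close>. It is determined only on the points of \<open>K/E\<close>.\<close>

definition natural_projection ::
    "'a topology \<Rightarrow> ('a \<times> 'a) set \<Rightarrow> ('a \<times> 'a) set \<Rightarrow> ('a set \<Rightarrow> 'a set) \<Rightarrow> bool" where
  "natural_projection K E E' q \<longleftrightarrow>
     continuous_map (quotient_space K E) (quotient_space K E') q \<and>
     q ` topspace (quotient_space K E) = topspace (quotient_space K E') \<and>
     (\<forall>x\<in>topspace K. q (quotient_proj E x) = quotient_proj E' x)"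

definition quotient_le :: "'a topology \<Rightarrow> ('a \<times> 'a) set \<Rightarrow> ('a \<times> 'a) set \<Rightarrow> bool" where
  "quotient_le K E' E \<longleftrightarrow> (\<exists>q. natural_projection K E E' q)"

definition quotient_sup :: "'a topology \<Rightarrow> ('a \<times> 'a) set set \<Rightarrow> ('a \<times> 'a) set \<Rightarrow> bool" where
  "quotient_sup K T E \<longleftrightarrow>
     E \<in> hausdorff_quotients K \<and> (\<forall>F\<in>T. quotient_le K F E) \<and>
     (\<forall>G\<in>hausdorff_quotients K. (\<forall>F\<in>T. quotient_le K F G) \<longrightarrow> quotient_le K E G)"

definition cofinal_quotients :: "'a topology \<Rightarrow> ('a \<times> 'a) set set \<Rightarrow> bool" where
  "cofinal_quotients K S \<longleftrightarrow>
     S \<subseteq> countable_weight_quotients K \<and>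
     (\<forall>E\<in>countable_weight_quotients K. \<exists>E'\<in>S. quotient_le K E E')"

text \<open>The empty subset is included, so that a \<open>\<sigma>\<close>-semilattice contains the least quotient (one point
  if \<open>K\<close> is nonempty). Every sequence is trivially fiber convergent over it, hence this convention
  does not affect \<open>fiber_convergent\<close> below.\<close>

definition sigma_semilattice :: "'a topology \<Rightarrow> ('a \<times> 'a) set set \<Rightarrow> bool" where
  "sigma_semilattice K S \<longleftrightarrow>
     S \<subseteq> countable_weight_quotients K \<and>
     (\<forall>T. countable T \<and> T \<subseteq> S \<longrightarrow> (\<exists>E\<in>S. quotient_sup K T E))"


section \<open>Fiber convergent sequences\<close>

definition pi_fiber_convergent ::
    "'a topology \<Rightarrow> 'b topology \<Rightarrow> ('a \<Rightarrow> 'b) \<Rightarrow> (nat \<Rightarrow> 'b) \<Rightarrow> 'b \<Rightarrow> bool" where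
  "pi_fiber_convergent M N \<pi> x l \<longleftrightarrow>
     range x \<subseteq> topspace N \<and> limitin N x l sequentially \<and>
     (\<forall>y\<in>topspace M. \<pi> y = l \<longrightarrow>
        (\<exists>z. (\<forall>n. z n \<in> topspace M \<and> \<pi> (z n) = x n) \<and> limitin M z y sequentially))"

definition fiber_convergent :: "'a topology \<Rightarrow> (nat \<Rightarrow> 'a) \<Rightarrow> 'a \<Rightarrow> bool" where
  "fiber_convergent K x l \<longleftrightarrow>
     compact_space K \<and> Hausdorff_space K \<and> \<not> second_countable K \<and>
     range x \<subseteq> topspace K \<and> limitin K x l sequentially \<and>
     (\<exists>S. cofinal_quotients K S \<and> sigma_semilattice K S \<and>
        (\<forall>E\<in>S. \<forall>E'\<in>S. \<forall>\<pi>. natural_projection K E E' \<pi> \<longrightarrow>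
           pi_fiber_convergent (quotient_space K E) (quotient_space K E') \<pi>
             (\<lambda>n. quotient_proj E' (x n)) (quotient_proj E' l)))"


section \<open>Classes of Banach spaces\<close>

text \<open>On the dual \<open>'a \<Rightarrow>\<^sub>L real\<close> the strong operator topology, i.e. the topology of pointwise
  convergence, is the weak* topology (see also \<open>limitin_weak_star\<close> below).\<close>

abbreviation weak_star :: "('a::real_normed_vector \<Rightarrow>\<^sub>L real) topology" where
  "weak_star \<equiv> strong_operator_topology"

definition dual_ball :: "('a::real_normed_vector \<Rightarrow>\<^sub>L real) topology" where
  "dual_ball = subtopology weak_star (cball 0 1)"

definition dual_kadec_klee :: "'a::banach itself \<Rightarrow> bool" where
  "dual_kadec_klee X \<longleftrightarrow>
     (\<forall>(f :: nat \<Rightarrow> 'a \<Rightarrow>\<^sub>L real) g.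
        limitin weak_star f g sequentially \<and> (\<lambda>n. norm (f n)) \<longlonglongrightarrow> norm g \<longrightarrow> convergent f)"

definition class_E :: "'a::banach itself \<Rightarrow> bool" where
  "class_E X \<longleftrightarrow>
     \<not> separable_space (euclidean :: 'a topology) \<and>
     {f :: nat \<Rightarrow> 'a \<Rightarrow>\<^sub>L real. \<exists>g. fiber_convergent dual_ball f g} =
     {f. range f \<subseteq> cball 0 1 \<and> convergent f}"

definition class_E0 :: "'a::banach itself \<Rightarrow> bool" where
  "class_E0 X \<longleftrightarrow>
     \<not> separable_space (euclidean :: 'a topology) \<and>
     {f :: nat \<Rightarrow> 'a \<Rightarrow>\<^sub>L real. \<exists>g. fiber_convergent dual_ball f g} =
     {f. range f \<subseteq> cball 0 1 \<and>
         (\<exists>g\<in>cball 0 1. limitin weak_star f g sequentially \<and>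
                        (\<lambda>n. norm (f n)) \<longlonglongrightarrow> norm g)}"


section \<open>Basic facts\<close>

lemma openin_quotient_space:
  "openin (quotient_space K E) U \<longleftrightarrow>
     U \<subseteq> topspace K // E \<and> openin K {x \<in> topspace K. E `` {x} \<in> U}"
proof -
  have "istopology (\<lambda>U. U \<subseteq> topspace K // E \<and> openin K {x \<in> topspace K. E `` {x} \<in> U})"
    unfolding istopology_def
  proof (rule conjI; intro allI impI)
    fix S T
    assume S: "S \<subseteq> topspace K // E \<and> openin K {x \<in> topspace K. E `` {x} \<in> S}"
      and T: "T \<subseteq> topspace K // E \<and> openin K {x \<in> topspace K. E `` {x} \<in> T}"
    have "{x \<in> topspace K. E `` {x} \<in> S \<inter> T} =
          {x \<in> topspace K. E `` {x} \<in> S} \<inter> {x \<in> topspace K. E `` {x} \<in> T}"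
      by auto
    then show "S \<inter> T \<subseteq> topspace K // E \<and> openin K {x \<in> topspace K. E `` {x} \<in> S \<inter> T}"
      using S T by (auto simp only: openin_Int)
  next
    fix \<K>
    assume *: "\<forall>S\<in>\<K>. S \<subseteq> topspace K // E \<and> openin K {x \<in> topspace K. E `` {x} \<in> S}"
    have "{x \<in> topspace K. E `` {x} \<in> \<Union>\<K>} =
          (\<Union>S\<in>\<K>. {x \<in> topspace K. E `` {x} \<in> S})"
      by auto
    moreover have "openin K (\<Union>S\<in>\<K>. {x \<in> topspace K. E `` {x} \<in> S})"
      using * by blast
    ultimately have "openin K {x \<in> topspace K. E `` {x} \<in> \<Union>\<K>}"
      by (simp only:)
    moreover have "\<Union>\<K> \<subseteq> topspace K // E"
      using * by blast
    ultimately show "\<Union>\<K> \<subseteq> topspace K // E \<and>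
        openin K {x \<in> topspace K. E `` {x} \<in> \<Union>\<K>}"
      by blast
  qed
  then show ?thesis
    unfolding quotient_space_def by (simp only: topology_inverse')
qed

lemma topspace_quotient_space: "topspace (quotient_space K E) = topspace K // E"
proof -
  have "{x \<in> topspace K. E `` {x} \<in> topspace K // E} = topspace K"
    by (auto intro: quotientI)
  then have "openin (quotient_space K E) (topspace K // E)"
    by (simp add: openin_quotient_space)
  then show ?thesis
    by (meson openin_quotient_space openin_subset openin_topspace subset_antisym)
qed

lemma quotient_map_quotient_proj: "quotient_map K (quotient_space K E) (quotient_proj E)"
  unfolding quotient_map_def topspace_quotient_space
  by (auto simp: openin_quotient_space quotient_proj_def quotient_def)

lemma quotient_le_iff:
  assumes "equiv (topspace K) E" "equiv (topspace K) E'"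
  shows "quotient_le K E' E \<longleftrightarrow> E \<subseteq> E'"
proof
  assume "quotient_le K E' E"
  then obtain q where "natural_projection K E E' q"
    unfolding quotient_le_def by blast
  then have q: "q (E `` {x}) = E' `` {x}" if "x \<in> topspace K" for x
    using that by (simp add: natural_projection_def quotient_proj_def)
  show "E \<subseteq> E'"
  proof clarify
    fix x y assume xy: "(x, y) \<in> E"
    then have "x \<in> topspace K" "y \<in> topspace K" "E `` {x} = E `` {y}"
      using equiv_class_eq[OF assms(1)] assms(1) unfolding equiv_def by blast+
    then have "E' `` {x} = E' `` {y}"
      using q by metis
    then show "(x, y) \<in> E'"
      using eq_equiv_class[OF _ assms(2)] \<open>y \<in> topspace K\<close> by blast
  qed
next
  assume sub: "E \<subseteq> E'"
  have q: "E' `` (E `` {x}) = E' `` {x}" if "x \<in> topspace K" for x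
  proof
    show "E' `` (E `` {x}) \<subseteq> E' `` {x}"
      using sub assms(2) by (auto simp: equiv_def dest: transD)
    show "E' `` {x} \<subseteq> E' `` (E `` {x})"
      using equiv_class_self[OF assms(1) that] by blast
  qed
  have "continuous_map K (quotient_space K E') (Image E' \<circ> quotient_proj E)"
    using quotient_imp_continuous_map[OF quotient_map_quotient_proj]
    by (rule continuous_map_eq) (simp add: quotient_proj_def q)
  then have "continuous_map (quotient_space K E) (quotient_space K E') (Image E')"
    using continuous_compose_quotient_map_eq[OF quotient_map_quotient_proj] by blast
  moreover have "Image E' ` (topspace K // E) = topspace K // E'"
    by (auto simp: quotient_def q image_iff)
  ultimately have "natural_projection K E E' (Image E')"
    by (simp add: natural_projection_def topspace_quotient_space quotient_proj_def q)
  then show "quotient_le K E' E"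
    unfolding quotient_le_def by blast
qed

lemma quotient_sup_Inter:
  assumes T: "T \<subseteq> hausdorff_quotients K" "T \<noteq> {}"
  shows "quotient_sup K T (\<Inter>T)"
proof -
  have eq: "equiv (topspace K) F" if "F \<in> T" for F
    using T that by (auto simp: hausdorff_quotients_def)
  have eqI: "equiv (topspace K) (\<Inter>T)"
  proof (rule equivI)
    show "\<Inter>T \<subseteq> topspace K \<times> topspace K"
      using eq T(2) unfolding equiv_def by blast
    show "refl_on (topspace K) (\<Inter>T)"
      using eq unfolding equiv_def refl_on_def by blast
    show "sym (\<Inter>T)"
      using eq unfolding equiv_def sym_def by blast
    show "trans (\<Inter>T)"
      using eq unfolding equiv_def trans_def by blast
  qed
  have le: "quotient_le K F (\<Inter>T)" if "F \<in> T" for F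
    using quotient_le_iff[OF eqI eq[OF that]] that by blast
  have "Hausdorff_space (quotient_space K (\<Inter>T))"
    unfolding Hausdorff_space_def
  proof clarify
    fix a b
    assume ab: "a \<in> topspace (quotient_space K (\<Inter>T))" "b \<in> topspace (quotient_space K (\<Inter>T))"
      and "a \<noteq> b"
    then obtain x y where x: "x \<in> topspace K" "a = \<Inter>T `` {x}" and y: "y \<in> topspace K" "b = \<Inter>T `` {y}"
      by (auto simp: topspace_quotient_space elim!: quotientE)
    then have "(x, y) \<notin> \<Inter>T"
      using \<open>a \<noteq> b\<close> equiv_class_eq[OF eqI] by blast
    then obtain F where F: "F \<in> T" "(x, y) \<notin> F"
      by blast
    then have ne: "F `` {x} \<noteq> F `` {y}"
      using eq_equiv_class[OF _ eq[OF F(1)]] y by blast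
    obtain q where q: "natural_projection K (\<Inter>T) F q"
      using le[OF F(1)] unfolding quotient_le_def by blast
    have cont: "continuous_map (quotient_space K (\<Inter>T)) (quotient_space K F) q"
      and qa: "q a = F `` {x}" and qb: "q b = F `` {y}"
      using q x y by (auto simp: natural_projection_def quotient_proj_def)
    have "Hausdorff_space (quotient_space K F)"
      using F T by (auto simp: hausdorff_quotients_def)
    moreover have "q a \<in> topspace (quotient_space K F)" "q b \<in> topspace (quotient_space K F)"
      using cont ab by (auto simp: continuous_map_def)
    ultimately obtain U V where UV: "openin (quotient_space K F) U" "openin (quotient_space K F) V"
      "q a \<in> U" "q b \<in> V" "disjnt U V"
      using ne qa qb unfolding Hausdorff_space_def by metis
    let ?P = "\<lambda>W. {z \<in> topspace (quotient_space K (\<Inter>T)). q z \<in> W}"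
    have "openin (quotient_space K (\<Inter>T)) (?P U)" "openin (quotient_space K (\<Inter>T)) (?P V)"
      using cont UV openin_continuous_map_preimage by blast+
    moreover have "a \<in> ?P U" "b \<in> ?P V" "disjnt (?P U) (?P V)"
      using ab UV by (auto simp: disjnt_iff)
    ultimately show "\<exists>U V. openin (quotient_space K (\<Inter>T)) U \<and>
        openin (quotient_space K (\<Inter>T)) V \<and> a \<in> U \<and> b \<in> V \<and> disjnt U V"
      by blast
  qed
  then have "\<Inter>T \<in> hausdorff_quotients K"
    using eqI by (simp add: hausdorff_quotients_def)
  moreover have "quotient_le K (\<Inter>T) G"
    if "G \<in> hausdorff_quotients K" "\<forall>F\<in>T. quotient_le K F G" for G
  proof -
    have G: "equiv (topspace K) G"
      using that by (simp add: hausdorff_quotients_def)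
    then show ?thesis
      using that(2) quotient_le_iff[OF G eq] quotient_le_iff[OF G eqI] by blast
  qed
  ultimately show ?thesis
    using le by (auto simp: quotient_sup_def)
qed

lemma limitin_weak_star:
  fixes f :: "nat \<Rightarrow> 'a::real_normed_vector \<Rightarrow>\<^sub>L real"
  shows "limitin weak_star f g sequentially \<longleftrightarrow> (\<forall>v. (\<lambda>n. f n v) \<longlonglongrightarrow> g v)"
proof
  assume "limitin weak_star f g sequentially"
  then have "limitin euclidean ((\<lambda>h. blinfun_apply h v) \<circ> f) (g v) sequentially" for v
    using continuous_map_limit[OF strong_operator_topology_continuous_evaluation] by blast
  then show "\<forall>v. (\<lambda>n. f n v) \<longlonglongrightarrow> g v"
    by (simp add: o_def limitin_canonical_iff)
next
  assume *: "\<forall>v. (\<lambda>n. f n v) \<longlonglongrightarrow> g v"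
  have "limitin (euclidean :: ('a \<Rightarrow> real) topology) (\<lambda>n. blinfun_apply (f n)) (blinfun_apply g) sequentially"
    using * by (simp add: euclidean_product_topology[symmetric] limitin_componentwise)
  then show "limitin weak_star f g sequentially"
    unfolding limitin_def strong_operator_topology_def topspace_pullback_topology
      openin_pullback_topology
    by (fastforce elim: eventually_mono)
qed

end

theory Submission
  imports Defs
begin

text \<open>\<open>class_E\<close> and \<open>class_E0\<close> each prescribe what the set of fiber
  convergent sequences of the dual ball is. For a space in \<open>class_E0\<close>, being in
  \<open>class_E\<close> therefore means that the two prescribed sets coincide. By
  \<open>dual_kadec_klee_iff_sequences_eq\<close> this coincidence is the dual Kadec-Klee property:
  one inclusion always holds, and the other is that property for sequences in the unit ball, which
  by homogeneity (\<open>dual_kadec_klee_iff_unit_ball\<close>) gives it for all sequences.\<close>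

lemma limitin_weak_star_scaleR:
  fixes f :: "nat \<Rightarrow> 'a::real_normed_vector \<Rightarrow>\<^sub>L real"
  assumes "limitin weak_star f g sequentially"
  shows "limitin weak_star (\<lambda>n. c *\<^sub>R f n) (c *\<^sub>R g) sequentially"
  using assms by (simp add: limitin_weak_star blinfun.scaleR_left tendsto_mult_left)

lemma limitin_weak_star_tendsto:
  fixes f :: "nat \<Rightarrow> 'a::real_normed_vector \<Rightarrow>\<^sub>L real"
  assumes "f \<longlonglongrightarrow> g"
  shows "limitin weak_star f g sequentially"
  using assms by (auto simp: limitin_weak_star intro!: tendsto_intros)

text \<open>Weak* convergence, convergence of the norms and norm convergence all survive
  multiplication by a scalar, so a bounded sequence can be shrunk into the ball and scaled
  back.\<close>

lemma dual_kadec_klee_iff_unit_ball: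
  "dual_kadec_klee TYPE('a::banach) \<longleftrightarrow>
     (\<forall>(f :: nat \<Rightarrow> 'a \<Rightarrow>\<^sub>L real) g.
        range f \<subseteq> cball 0 1 \<and> g \<in> cball 0 1 \<and> limitin weak_star f g sequentially \<and>
        (\<lambda>n. norm (f n)) \<longlonglongrightarrow> norm g \<longrightarrow> convergent f)" (is "_ \<longleftrightarrow> ?ball")
proof
  assume ball: ?ball
  show "dual_kadec_klee TYPE('a)"
    unfolding dual_kadec_klee_def
  proof (intro allI impI, elim conjE)
    fix f :: "nat \<Rightarrow> 'a \<Rightarrow>\<^sub>L real" and g
    assume lim: "limitin weak_star f g sequentially"
      and norm_lim: "(\<lambda>n. norm (f n)) \<longlonglongrightarrow> norm g"
    \<comment> \<open>The norms converge, hence are bounded; the same bound passes to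
      \<open>norm g\<close>, so one factor \<open>inverse C\<close> moves both the sequence and its
      limit into the ball.\<close>
    obtain C where C: "C > 0" "\<And>n. norm (f n) \<le> C"
      using convergent_imp_Bseq[OF convergentI[OF norm_lim]] by (auto elim: BseqE)
    have "norm g \<le> C"
      using LIMSEQ_le_const2[OF norm_lim] C(2) by blast
    let ?h = "\<lambda>n. inverse C *\<^sub>R f n"
    have "range ?h \<subseteq> cball 0 1" "inverse C *\<^sub>R g \<in> cball 0 1"
      using C \<open>norm g \<le> C\<close> by (auto simp: field_simps)
    moreover have "(\<lambda>n. norm (?h n)) \<longlonglongrightarrow> norm (inverse C *\<^sub>R g)"
      using norm_lim by (auto intro!: tendsto_intros)
    ultimately have "convergent ?h"
      using ball limitin_weak_star_scaleR[OF lim] by blast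
    then obtain l where "?h \<longlonglongrightarrow> l"
      by (auto simp: convergent_def)
    then have "(\<lambda>n. C *\<^sub>R ?h n) \<longlonglongrightarrow> C *\<^sub>R l"
      by (intro tendsto_intros)
    then show "convergent f"
      using C(1) by (auto simp: convergent_def)
  qed
qed (auto simp: dual_kadec_klee_def)

text \<open>The inclusion from right to left holds in every Banach space: a norm limit stays in the
  closed ball, is also the weak* limit, and the norm is continuous. Only the other inclusion carries
  the Kadec-Klee property.\<close>

lemma dual_kadec_klee_iff_sequences_eq:
  "dual_kadec_klee TYPE('a::banach) \<longleftrightarrow>
     {f :: nat \<Rightarrow> 'a \<Rightarrow>\<^sub>L real. range f \<subseteq> cball 0 1 \<and>
         (\<exists>g\<in>cball 0 1. limitin weak_star f g sequentially \<and>
                        (\<lambda>n. norm (f n)) \<longlonglongrightarrow> norm g)} =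
     {f. range f \<subseteq> cball 0 1 \<and> convergent f}"
proof -
  have "\<exists>g\<in>cball 0 1. limitin weak_star f g sequentially \<and> (\<lambda>n. norm (f n)) \<longlonglongrightarrow> norm g"
    if ball: "range f \<subseteq> cball 0 1" and conv: "convergent f" for f :: "nat \<Rightarrow> 'a \<Rightarrow>\<^sub>L real"
  proof -
    obtain g where g: "f \<longlonglongrightarrow> g"
      using conv by (auto simp: convergent_def)
    have "g \<in> cball 0 1"
      using closed_sequentially[OF closed_cball _ g] ball by blast
    then show ?thesis
      using limitin_weak_star_tendsto[OF g] tendsto_norm[OF g] by blast
  qed
  then show ?thesis
    unfolding dual_kadec_klee_iff_unit_ball by blast
qed

theorem mainTheorem5:
  shows "class_E0 TYPE('a::banach) \<and> class_E TYPE('a) \<longleftrightarrow>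
         class_E0 TYPE('a) \<and> dual_kadec_klee TYPE('a)"
  \<comment> \<open>With A the set of fiber convergent sequences and B, C the two prescribed sets,
    what remains is that, given A = B, the equations A = C and B = C are equivalent.\<close>
  unfolding class_E0_def class_E_def dual_kadec_klee_iff_sequences_eq by argo

end
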